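(* Let $(G_m)_{m\in\mathbb{Z}}$ be a generalized Fibonacci sequence, let $a,b$ be integers, let $n\ge 0$ be an integer, and let $x$ be a complex number such that $\Delta := 1-L_b x+(-1)^b x^2\neq 0$. Then $$\begin{aligned} \sum_{k=0}^n x^k k^3 G_{a+bk} = {}& -\frac{1}{\Delta}(n+1)^3 x^{n+1} P(1,n+1) \\ & - \frac{1}{\Delta^2} \left[ (3n^2+9n+7) x^{n+2} P(2,n+2) - x P(2,1) \right] \\ & - \frac{6}{\Delta^3} \left[ (n+2) x^{n+3} P(3,n+3) - x^2 P(3,2) \right] \\ & - \frac{6}{\Delta^4} \left[ x^{n+4} P(4,n+4) - x^3 P(4,3) \right]. \end{aligned}$$
   Context: A generalized Fibonacci sequence is a sequence $(G_m)_{m\in\mathbb{Z}}$ of complex numbers with $G_{m+2}=G_{m+1}+G_m$ for all integers $m$ (with arbitrary seed $G_0,G_1$). $L_m$ is the Lucas number: $L_0=2$, $L_1=1$, $L_{m+2}=L_{m+1}+L_m$ for all integers $m$ (including negative indices). For given $a,b,x$ and $G$, and for integers $v,w\ge 0$, $P(v,w) = \sum_{k=0}^v \binom{v}{k} (-1)^{(b+1)k} x^k G_{a+bw-bk}$. Convention: $x^0=1$, also for $x=0$. *)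

theory Defs
  imports Complex_Main
begin

definition gen_fib :: "(int \<Rightarrow> complex) \<Rightarrow> bool" where
  "gen_fib G \<longleftrightarrow> (\<forall>m. G (m + 2) = G (m + 1) + G m)"

text \<open>Lucas numbers on all integers; for negative indices the recurrence is run backwards.\<close>

function lucas :: "int \<Rightarrow> int" where
  "lucas m =
    (if m = 0 then 2
     else if m = 1 then 1
     else if m > 1 then lucas (m - 1) + lucas (m - 2)
     else lucas (m + 2) - lucas (m + 1))"
  by auto
termination
  by (relation "measure (\<lambda>m. nat \<bar>2 * m - 1\<bar>)") auto

declare lucas.simps [simp del]

lemma lucas_0: "lucas 0 = 2"
  by (simp add: lucas.simps)

lemma lucas_1: "lucas 1 = 1"
  by (simp add: lucas.simps)

lemma lucas_rec: "lucas (m + 2) = lucas (m + 1) + lucas m"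
proof (cases "m \<ge> 0")
  case True
  then show ?thesis by (subst lucas.simps) (simp add: algebra_simps)
next
  case False
  then have "lucas m = lucas (m + 2) - lucas (m + 1)"
    by (subst lucas.simps) simp
  then show ?thesis by simp
qed

text \<open>Exponents of \<open>-1\<close> are integers of either sign, hence \<open>powi\<close>.\<close>

definition P :: "(int \<Rightarrow> complex) \<Rightarrow> int \<Rightarrow> int \<Rightarrow> complex \<Rightarrow> nat \<Rightarrow> nat \<Rightarrow> complex" where
  "P G a b x v w =
    (\<Sum>k = 0..v. of_nat (v choose k) * (-1) powi ((b + 1) * int k) * x ^ k
       * G (a + b * int w - b * int k))"

definition Delta :: "int \<Rightarrow> complex \<Rightarrow> complex" where
  "Delta b x = 1 - of_int (lucas b) * x + (-1) powi b * x ^ 2"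

end

(* Put q v w = P(v,w) / Delta^v.  The Lucas identity L_b G_m = G_{m+b} + (-1)^b G_{m-b} and
   Pascal's rule give q (v+1) w - x q (v+1) (w+1) = q v w, while q 0 k = G_{a+bk}.  So passing
   from v to v+1 is a discrete antiderivative, and the formula is a repeated summation by parts
   that ends because the third difference of k^3 is constant. *)
theory Submission
  imports Defs
begin

lemma gen_fibD: "gen_fib G \<Longrightarrow> G (m + 2) = G (m + 1) + G m"
  by (simp add: gen_fib_def)

text \<open>The recurrence runs in both directions from two consecutive values, so the induction
  over the integers carries such a pair.\<close>

lemma gen_fib_eqI:
  assumes F: "gen_fib F" and H: "gen_fib H" and "F 0 = H 0" "F 1 = H 1"
  shows "F m = H m"
proof -
  have "F m = H m \<and> F (m + 1) = H (m + 1)"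
  proof (induction m rule: int_induct [where k = 0])
    case base
    then show ?case using assms by simp
  next
    case (step1 i)
    then show ?case using gen_fibD [OF F, of i] gen_fibD [OF H, of i]
      by (simp add: add.assoc)
  next
    case (step2 i)
    then show ?case using gen_fibD [OF F, of "i - 1"] gen_fibD [OF H, of "i - 1"]
      by (simp add: algebra_simps)
  qed
  then show ?thesis ..
qed

text \<open>For fixed \<open>m\<close> both sides are generalized Fibonacci sequences in
  \<open>b\<close>, so comparing them at \<open>b = 0\<close> and \<open>b = 1\<close>
  suffices.\<close>

lemma lucas_mult_gen_fib:
  assumes "gen_fib G"
  shows "of_int (lucas b) * G m = G (m + b) + (-1) powi b * G (m - b)"
proof (rule gen_fib_eqI [where m = b])
  show "gen_fib (\<lambda>b. of_int (lucas b) * G m)"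
    by (simp add: gen_fib_def lucas_rec distrib_right)
  show "gen_fib (\<lambda>b. G (m + b) + (-1) powi b * G (m - b))"
    unfolding gen_fib_def
  proof
    fix b
    have "G (m + (b + 2)) = G (m + (b + 1)) + G (m + b)"
      using gen_fibD [OF assms, of "m + b"] by (simp add: add.assoc)
    moreover have "G (m - b) = G (m - (b + 1)) + G (m - (b + 2))"
      using gen_fibD [OF assms, of "m - (b + 2)"] by (simp add: algebra_simps)
    \<comment> \<open>The sign alternates in \<open>b\<close>, which turns the backward recurrence
      of \<open>G (m - b)\<close> into a forward one.\<close>
    ultimately show "G (m + (b + 2)) + (-1) powi (b + 2) * G (m - (b + 2)) =
        G (m + (b + 1)) + (-1) powi (b + 1) * G (m - (b + 1)) +
        (G (m + b) + (-1) powi b * G (m - b))"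
      by (simp add: power_int_add algebra_simps)
  qed
  show "of_int (lucas 0) * G m = G (m + 0) + (-1) powi 0 * G (m - 0)"
    by (simp add: lucas_0)
  show "of_int (lucas 1) * G m = G (m + 1) + (-1) powi 1 * G (m - 1)"
    using gen_fibD [OF assms, of "m - 1"] by (simp add: lucas_1 algebra_simps)
qed

lemma P_0: "P G a b x 0 w = G (a + b * int w)"
  by (simp add: P_def)

lemma P_Suc_right: "P G a b x v (Suc w) = P G (a + b) b x v w"
  by (simp add: P_def algebra_simps)

text \<open>The coefficients in \<open>P\<close> do not depend on \<open>a\<close>, so the Lucas
  identity can be applied term by term.\<close>

lemma lucas_mult_P:
  assumes "gen_fib G"
  shows "of_int (lucas b) * P G a b x v w =
    P G (a + b) b x v w + (-1) powi b * P G (a - b) b x v w"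
proof -
  have "of_int (lucas b) * G (a + b * int w - b * int k) =
      G (a + b + b * int w - b * int k) + (-1) powi b * G (a - b + b * int w - b * int k)" for k
    using lucas_mult_gen_fib [OF assms, of b "a + b * int w - b * int k"]
    by (simp add: algebra_simps)
  then have "of_int (lucas b) * (c * G (a + b * int w - b * int k)) =
      c * G (a + b + b * int w - b * int k) +
      (-1) powi b * (c * G (a - b + b * int w - b * int k))" for c k
    by (metis distrib_left mult.left_commute)
  then show ?thesis
    by (simp add: P_def sum_distrib_left flip: sum.distrib)
qed

text \<open>Pascal's rule splits the sum in two; in the second part an index shift in
  \<open>k\<close> lowers \<open>a\<close> by \<open>b\<close> and pulls out the factor
  \<open>(-1) powi (b + 1) * x\<close>.\<close>

lemma P_Suc_left:
  "P G a b x (Suc v) w = P G a b x v w - (-1) powi b * x * P G (a - b) b x v w"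
proof -
  define g where "g k = (-1) powi ((b + 1) * int k) * x ^ k * G (a + b * int w - b * int k)" for k
  have g_Suc: "g (Suc k) = - ((-1) powi b * x) *
      ((-1) powi ((b + 1) * int k) * x ^ k * G (a - b + b * int w - b * int k))" for k
  proof -
    have "(-1 :: complex) powi ((b + 1) * int (Suc k)) =
        - ((-1) powi b) * (-1) powi ((b + 1) * int k)"
      by (simp add: power_int_add distrib_left)
    moreover have "a + b * int w - b * int (Suc k) = a - b + b * int w - b * int k"
      by (simp add: algebra_simps)
    ultimately show ?thesis by (simp only: g_def power_Suc) (simp only: mult_minus_left mult_minus_right mult_ac)
  qed
  have P_g: "P G a b x u w = (\<Sum>k\<le>u. of_nat (u choose k) * g k)" for u
    by (simp add: P_def g_def mult.assoc atLeast0AtMost)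
  have "(\<Sum>k\<le>Suc v. of_nat (Suc v choose k) * g k) =
      g 0 + (\<Sum>k\<le>v. of_nat (v choose Suc k) * g (Suc k)) +
      (\<Sum>k\<le>v. of_nat (v choose k) * g (Suc k))"
    by (subst sum.atMost_Suc_shift) (simp add: distrib_right sum.distrib)
  also have "g 0 + (\<Sum>k\<le>v. of_nat (v choose Suc k) * g (Suc k)) =
      (\<Sum>k\<le>Suc v. of_nat (v choose k) * g k)"
    by (subst sum.atMost_Suc_shift) simp
  \<comment> \<open>The extra top term vanishes, since \<open>v choose Suc v\<close> is 0.\<close>
  also have "\<dots> = P G a b x v w"
    by (simp add: P_g)
  also have "(\<Sum>k\<le>v. of_nat (v choose k) * g (Suc k)) =
      - ((-1) powi b * x) * P G (a - b) b x v w"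
    by (simp only: g_Suc P_def sum_distrib_left atLeast0AtMost mult_ac)
  finally show ?thesis by (simp add: P_g)
qed

text \<open>Once the step in \<open>w\<close> is read as a shift of \<open>a\<close> by
  \<open>b\<close>, the left side involves only \<open>P\<close> at \<open>a - b\<close>,
  \<open>a\<close> and \<open>a + b\<close>; the outer two combine to the Lucas multiple, which
  gives the middle term of \<open>Delta\<close>.\<close>

lemma P_Suc_diff:
  assumes "gen_fib G"
  shows "P G a b x (Suc v) w - x * P G a b x (Suc v) (Suc w) = Delta b x * P G a b x v w"
proof -
  have "Delta b x * P G a b x v w =
      P G a b x v w - x * (of_int (lucas b) * P G a b x v w) + (-1) powi b * x\<^sup>2 * P G a b x v w"
    by (simp add: Delta_def algebra_simps)
  then show ?thesis
    unfolding lucas_mult_P [OF assms] P_Suc_right P_Suc_left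
    by (simp add: algebra_simps power2_eq_square)
qed

text \<open>The coefficients are \<open>(n + 1)^3\<close> and its successive forward differences
  \<open>3 * n^2 + 9 * n + 7\<close>, \<open>6 * (n + 2)\<close> and 6. The terms free of
  \<open>n\<close> are the constants of summation.\<close>

lemma sum_cube_antidifference:
  fixes q :: "nat \<Rightarrow> nat \<Rightarrow> 'a :: comm_ring_1"
  assumes "\<And>v w. q (Suc v) w - x * q (Suc v) (Suc w) = q v w"
  shows "(\<Sum>k = 0..n. x ^ k * of_nat k ^ 3 * q 0 k) =
      - (of_nat (n + 1) ^ 3 * x ^ (n + 1) * q 1 (n + 1))
      - (of_nat (3 * n ^ 2 + 9 * n + 7) * x ^ (n + 2) * q 2 (n + 2) - x * q 2 1)
      - 6 * (of_nat (n + 2) * x ^ (n + 3) * q 3 (n + 3) - x ^ 2 * q 3 2)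
      - 6 * (x ^ (n + 4) * q 4 (n + 4) - x ^ 3 * q 4 3)"
proof -
  have q1: "q 1 w = q 0 w + x * q 1 (w + 1)"
    and q2: "q 2 w = q 1 w + x * q 2 (w + 1)"
    and q3: "q 3 w = q 2 w + x * q 3 (w + 1)"
    and q4: "q 4 w = q 3 w + x * q 4 (w + 1)" for w
    using assms [of 0 w] assms [of 1 w] assms [of 2 w] assms [of 3 w]
    by (simp_all add: eval_nat_numeral algebra_simps)
  show ?thesis
  proof (induction n)
    case 0
    \<comment> \<open>The sum is 0 here; expanding the three constants makes the right side
      telescope to 0.\<close>
    have "q 2 1 = q 1 1 + x * q 2 2" "q 3 2 = q 2 2 + x * q 3 3" "q 4 3 = q 3 3 + x * q 4 4"
      using q2 [of 1] q3 [of 2] q4 [of 3] by (simp_all add: eval_nat_numeral)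
    then show ?case
      by simp (simp add: eval_nat_numeral algebra_simps)
  next
    case (Suc n)
    show ?case
      \<comment> \<open>Each \<open>q v (n + v)\<close> is advanced one step, so that apart from the
        constants only \<open>q 0 (n + 1)\<close> and the \<open>q v (n + v + 1)\<close>
        remain.\<close>
      unfolding sum.atLeast0_atMost_Suc Suc.IH q1 [of "n + 1"] q2 [of "n + 2"] q3 [of "n + 3"]
        q4 [of "n + 4"]
      by (simp add: eval_nat_numeral algebra_simps)
  qed
qed

theorem mainTheorem4:
  fixes G :: "int \<Rightarrow> complex" and a b :: int and n :: nat and x :: complex
  assumes "gen_fib G"
    and "Delta b x \<noteq> 0"
  shows "(\<Sum>k = 0..n. x ^ k * of_nat k ^ 3 * G (a + b * int k)) =
      - (1 / Delta b x) * of_nat (n + 1) ^ 3 * x ^ (n + 1) * P G a b x 1 (n + 1)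
      - 1 / Delta b x ^ 2 *
          (of_nat (3 * n ^ 2 + 9 * n + 7) * x ^ (n + 2) * P G a b x 2 (n + 2) - x * P G a b x 2 1)
      - 6 / Delta b x ^ 3 *
          (of_nat (n + 2) * x ^ (n + 3) * P G a b x 3 (n + 3) - x ^ 2 * P G a b x 3 2)
      - 6 / Delta b x ^ 4 *
          (x ^ (n + 4) * P G a b x 4 (n + 4) - x ^ 3 * P G a b x 4 3)"
proof -
  define q where "q v w = P G a b x v w / Delta b x ^ v" for v w
  have "q (Suc v) w - x * q (Suc v) (Suc w) = q v w" for v w
  proof -
    have "q (Suc v) w - x * q (Suc v) (Suc w) =
        (P G a b x (Suc v) w - x * P G a b x (Suc v) (Suc w)) / Delta b x ^ Suc v"
      by (simp only: q_def diff_divide_distrib times_divide_eq_right)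
    \<comment> \<open>One factor \<open>Delta b x\<close> cancels against the power in the
      denominator, which requires it to be nonzero.\<close>
    then show ?thesis
      using assms(2) by (simp add: P_Suc_diff [OF assms(1)] q_def)
  qed
  note sum_cube_antidifference [of q x n, OF this]
  moreover have "q 0 k = G (a + b * int k)" for k
    by (simp add: q_def P_0)
  ultimately show ?thesis
    by (simp add: q_def diff_divide_distrib mult.assoc)
qed

end
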